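(* Let $n\ge 1$, let $\mathbf{J}\in\mathbb{R}^{n\times n}$ be a nonzero symmetric matrix with $J_{ii}=0$ for all $i$, let $\lambda>0$, and let $\gamma=\gamma(\mathbf{J})>0$ be the margin of $\mathbf{J}$. Let $f_\theta:\mathbb{R}\to\mathbb{R}$ be a twice-differentiable function that is admissible for $(\lambda,\gamma)$, i.e. (1) $f_\theta(x)=f_\theta(-x)$ for all $x\in\mathbb{R}$; (2) $f_\theta''(x)<0$ for all $|x|<\lambda$; (3) $f_\theta'(\lambda)<0$; (4) $f_\theta'(\lambda)+\lambda\gamma>0$. Then $$\operatorname{loc}_{\lambda\mathbb{Q}_n}(\mathcal{H})=\lambda\operatorname{loc}_{\mathbb{H}_n}(\mathcal{E}),$$ where $\mathcal{E}(\boldsymbol{x})=-\tfrac12\boldsymbol{x}^\top\mathbf{J}\boldsymbol{x}$ and $\mathcal{H}(\boldsymbol{x})=\mathcal{E}(\boldsymbol{x})+\sum_{i=1}^n f_\theta(x_i)$.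
   Context: $\mathbb{H}_n=\{-1,1\}^n$, and $\lambda\mathbb{Q}_n=[-\lambda,\lambda]^n$. For $\boldsymbol{s},\boldsymbol{s}'\in\mathbb{H}_n$, $d_H(\boldsymbol{s},\boldsymbol{s}')$ is the number of indices $i$ with $s_i\neq s_i'$. A vector $\boldsymbol{s}^*\in\mathbb{H}_n$ is a one-flip local minimum of $\mathcal{E}$ if $\mathcal{E}(\boldsymbol{s}^* )\le\mathcal{E}(\boldsymbol{s})$ for all $\boldsymbol{s}\in\mathbb{H}_n$ with $d_H(\boldsymbol{s}^*,\boldsymbol{s})\le 1$. $\operatorname{loc}_{\mathbb{H}_n}(\mathcal{E})$ denotes the set of one-flip local minima of $\mathcal{E}$, equivalently the set $\{\boldsymbol{s}\in\mathbb{H}_n: s_i(\mathbf{J}\boldsymbol{s})_i\ge 0\ \forall i\}$, and $\lambda\operatorname{loc}_{\mathbb{H}_n}(\mathcal{E})=\{\lambda\boldsymbol{s}:\boldsymbol{s}\in\operatorname{loc}_{\mathbb{H}_n}(\mathcal{E})\}$. $\operatorname{loc}_{\lambda\mathbb{Q}_n}(\mathcal{H})$ denotes the set of (not necessarily strict) local minima of $\mathcal{H}$ over the constraint set $\lambda\mathbb{Q}_n$. For $\mathbf{J}\ne\mathbf{0}$, the margin is $\gamma(\mathbf{J})=\min\{|(\mathbf{J}\boldsymbol{s})_i| : \boldsymbol{s}\in\mathbb{H}_n,\ 1\le i\le n,\ s_i(\mathbf{J}\boldsymbol{s})_i<0\}$, a minimum over a nonempty finite set of positive numbers. *)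

theory Defs
  imports "HOL-Analysis.Analysis"
begin

definition hypercube :: "(real ^ 'n) set" where
  "hypercube = {s. \<forall>i. s $ i \<in> {-1, 1}}"

definition scaled_cube :: "real \<Rightarrow> (real ^ 'n) set" where
  "scaled_cube lam = {x. \<forall>i. x $ i \<in> {-lam..lam}}"

definition hamming_dist :: "real ^ 'n \<Rightarrow> real ^ 'n \<Rightarrow> nat" where
  "hamming_dist s t = card {i. s $ i \<noteq> t $ i}"

definition one_flip_minima :: "(real ^ 'n \<Rightarrow> real) \<Rightarrow> (real ^ 'n) set" where
  "one_flip_minima F =
     {s \<in> hypercube. \<forall>t \<in> hypercube. hamming_dist s t \<le> 1 \<longrightarrow> F s \<le> F t}"

text \<open>Local minima need not be strict, and only competitors inside the constraint
  set \<open>S\<close> are considered.\<close>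
definition local_minima_on :: "'a::metric_space set \<Rightarrow> ('a \<Rightarrow> real) \<Rightarrow> 'a set" where
  "local_minima_on S F =
     {x \<in> S. \<exists>\<epsilon>>0. \<forall>y \<in> S. dist y x < \<epsilon> \<longrightarrow> F x \<le> F y}"

definition energy :: "real ^ 'n ^ 'n \<Rightarrow> real ^ 'n \<Rightarrow> real" where
  "energy J x = - (1 / 2) * (x \<bullet> (J *v x))"

definition hamiltonian ::
  "real ^ 'n ^ 'n \<Rightarrow> (real \<Rightarrow> real) \<Rightarrow> real ^ 'n \<Rightarrow> real" where
  "hamiltonian J f x = energy J x + (\<Sum>i\<in>UNIV. f (x $ i))"

text \<open>The set below is always finite. It is nonempty when \<open>J\<close> is nonzero with zero
  diagonal (flipping coordinate \<open>i\<close> negates \<open>s\<^sub>i (J s)\<^sub>i\<close>); for other matrices it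
  may be empty, and then the value of \<open>Min\<close> carries no meaning.\<close>
definition margin :: "real ^ 'n ^ 'n \<Rightarrow> real" where
  "margin J =
     Min {\<bar>(J *v s) $ i\<bar> | s i. s \<in> hypercube \<and> s $ i * (J *v s) $ i < 0}"

definition twice_differentiable :: "(real \<Rightarrow> real) \<Rightarrow> bool" where
  "twice_differentiable f \<longleftrightarrow>
     (\<forall>x. f differentiable (at x)) \<and> (\<forall>x. deriv f differentiable (at x))"

definition admissible :: "real \<Rightarrow> real \<Rightarrow> (real \<Rightarrow> real) \<Rightarrow> bool" where
  "admissible lam \<gamma> f \<longleftrightarrow>
     (\<forall>x. f x = f (- x)) \<and>
     (\<forall>x. \<bar>x\<bar> < lam \<longrightarrow> deriv (deriv f) x < 0) \<and>
     deriv f lam < 0 \<and>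
     deriv f lam + lam * \<gamma> > 0"

end

theory Submission
  imports Defs
begin

text \<open>Because the diagonal of \<open>J\<close> vanishes, the energy is affine along every coordinate line.
  Strict concavity of \<open>f\<close> on the open interval therefore excludes local minima with an interior
  coordinate, so they all have the form \<open>\<lambda> s\<close> with \<open>s\<close> a vertex of the hypercube. At such a point, moving
  coordinate \<open>i\<close> inwards changes the Hamiltonian at rate \<open>\<lambda> s\<^sub>i (J s)\<^sub>i - f'(\<lambda>)\<close>. If \<open>s\<^sub>i (J s)\<^sub>i < 0\<close>
  this is at most \<open>-\<lambda> \<gamma> - f'(\<lambda>) < 0\<close>; if \<open>s\<^sub>i (J s)\<^sub>i \<ge> 0\<close> for all \<open>i\<close>, all these rates are at least
  \<open>-f'(\<lambda>) > 0\<close>, and this linear gain dominates the quadratic remainder of the energy.\<close>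

section \<open>The hypercube and the margin\<close>

lemma finite_hypercube: "finite (hypercube :: (real ^ 'n) set)"
proof -
  have "(hypercube :: (real ^ 'n) set) \<subseteq> (\<lambda>g. \<chi> i. g i) ` (PiE UNIV (\<lambda>_. {-1, 1}))"
  proof
    fix s :: "real ^ 'n"
    assume "s \<in> hypercube"
    then have "vec_nth s \<in> PiE UNIV (\<lambda>_. {-1, 1})" and "s = (\<chi> i. s $ i)"
      by (auto simp: hypercube_def)
    then show "s \<in> (\<lambda>g. \<chi> i. g i) ` (PiE UNIV (\<lambda>_. {-1, 1}))"
      by blast
  qed
  then show ?thesis
    by (rule finite_subset) (intro finite_imageI finite_PiE, auto)
qed

text \<open>Finiteness of the hypercube makes \<open>Min\<close> a true lower bound, and the given
  pair \<open>s\<close>, \<open>i\<close> contributes an element. Since \<open>s $ i\<close> is a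
  sign, that element is the absolute value of the negative product.\<close>

lemma margin_le:
  fixes J :: "real ^ 'n ^ 'n"
  assumes "s \<in> hypercube" "s $ i * (J *v s) $ i < 0"
  shows "margin J \<le> - (s $ i * (J *v s) $ i)"
proof -
  let ?M = "{\<bar>(J *v s) $ i\<bar> | s i. s \<in> hypercube \<and> s $ i * (J *v s) $ i < 0}"
  have "finite ((\<lambda>(s, i). \<bar>(J *v s) $ i\<bar>) ` (hypercube \<times> UNIV))"
    by (intro finite_imageI finite_cartesian_product finite_hypercube) simp
  then have "finite ?M"
    by (rule rev_finite_subset) auto
  then have "margin J \<le> \<bar>(J *v s) $ i\<bar>"
    unfolding margin_def by (rule Min_le) (use assms in blast)
  also have "\<bar>s $ i\<bar> = 1"
    using assms(1) by (auto simp: hypercube_def dest: spec[of _ i])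
  then have "\<bar>(J *v s) $ i\<bar> = \<bar>s $ i * (J *v s) $ i\<bar>"
    by (simp add: abs_mult)
  finally show ?thesis
    using assms(2) by simp
qed

section \<open>Moves along coordinate lines: the energy, the Hamiltonian, one concave
  summand\<close>

lemma energy_add:
  fixes J :: "real ^ 'n ^ 'n"
  assumes "transpose J = J"
  shows "energy J (x + z) = energy J x - z \<bullet> (J *v x) - (1 / 2) * (z \<bullet> (J *v z))"
proof -
  have "x \<bullet> (J *v z) = z \<bullet> (J *v x)"
    using assms by (metis dot_lmul_matrix inner_commute transpose_matrix_vector)
  then show ?thesis
    by (simp add: energy_def matrix_vector_right_distrib inner_add_left inner_add_right field_simps)
qed

text \<open>The term quadratic in \<open>t\<close> is a multiple of \<open>J $ i $ i\<close>, so a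
  zero diagonal entry leaves only the linear term.\<close>

lemma energy_add_axis:
  fixes J :: "real ^ 'n ^ 'n"
  assumes "transpose J = J" "J $ i $ i = 0"
  shows "energy J (x + axis i t) = energy J x - t * (J *v x) $ i"
proof -
  have "(J *v axis i t) $ i = 0"
    using assms(2) by (simp add: matrix_vector_mult_def axis_def if_distrib cong: if_cong)
  then show ?thesis
    by (simp add: energy_add[OF assms(1)] inner_axis')
qed

lemma hamiltonian_add_axis:
  fixes J :: "real ^ 'n ^ 'n"
  assumes "transpose J = J" "J $ i $ i = 0"
  shows "hamiltonian J f (x + axis i t)
           = hamiltonian J f x - t * (J *v x) $ i + f (x $ i + t) - f (x $ i)"
proof -
  have "(\<Sum>j\<in>UNIV. f ((x + axis i t) $ j)) = f (x $ i + t) + (\<Sum>j\<in>UNIV - {i}. f ((x + axis i t) $ j))"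
    by (subst sum.remove[of _ i]) auto
  also have "(\<Sum>j\<in>UNIV - {i}. f ((x + axis i t) $ j)) = (\<Sum>j\<in>UNIV - {i}. f (x $ j))"
    by (rule sum.cong) (auto simp: axis_def)
  also have "\<dots> = (\<Sum>j\<in>UNIV. f (x $ j)) - f (x $ i)"
    by (subst sum.remove[of UNIV i]) auto
  finally show ?thesis
    by (simp add: hamiltonian_def energy_add_axis[OF assms])
qed

text \<open>Flipping coordinate \<open>i\<close> means adding \<open>axis i (- 2 * s $ i)\<close>,
  which raises the energy by \<open>2 * (s $ i * (J *v s) $ i)\<close>. The competitors are
  \<open>s\<close> itself and these flips.\<close>

lemma one_flip_minima_energy:
  fixes J :: "real ^ 'n ^ 'n"
  assumes "transpose J = J" "\<And>i. J $ i $ i = 0"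
  shows "one_flip_minima (energy J) = {s \<in> hypercube. \<forall>i. 0 \<le> s $ i * (J *v s) $ i}"
proof (intro equalityI subsetI)
  fix s
  assume s: "s \<in> one_flip_minima (energy J)"
  then have hyp: "s \<in> hypercube"
    by (simp add: one_flip_minima_def)
  have "0 \<le> s $ i * (J *v s) $ i" for i
  proof -
    let ?t = "s + axis i (- 2 * s $ i)"
    have "?t \<in> hypercube"
      unfolding hypercube_def
    proof (intro CollectI allI)
      show "?t $ j \<in> {-1, 1}" for j
        using hyp by (cases "j = i") (auto simp: hypercube_def axis_def dest: spec[of _ j])
    qed
    moreover have "{j. s $ j \<noteq> ?t $ j} \<subseteq> {i}"
      by (auto simp: axis_def)
    then have "hamming_dist s ?t \<le> 1"
      unfolding hamming_dist_def using card_mono[of "{i}" "{j. s $ j \<noteq> ?t $ j}"] by simp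
    ultimately have "energy J s \<le> energy J ?t"
      using s by (simp add: one_flip_minima_def)
    then show ?thesis
      unfolding energy_add_axis[OF assms] by simp
  qed
  with hyp show "s \<in> {s \<in> hypercube. \<forall>i. 0 \<le> s $ i * (J *v s) $ i}"
    by blast
next
  fix s
  assume "s \<in> {s \<in> hypercube. \<forall>i. 0 \<le> s $ i * (J *v s) $ i}"
  then have hyp: "s \<in> hypercube" and nonneg: "\<And>i. 0 \<le> s $ i * (J *v s) $ i"
    by blast+
  have "energy J s \<le> energy J t" if t: "t \<in> hypercube" and d: "hamming_dist s t \<le> 1" for t
  proof (cases "s = t")
    case False
    then obtain i where i: "s $ i \<noteq> t $ i"
      by (auto simp: vec_eq_iff)
    have "t $ j = s $ j" if "j \<noteq> i" for j
    proof -
      have "\<forall>k\<in>{k. s $ k \<noteq> t $ k}. \<forall>l\<in>{k. s $ k \<noteq> t $ k}. k = l"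
        using d card_le_Suc0_iff_eq[of "{k. s $ k \<noteq> t $ k}"] by (simp only: hamming_dist_def One_nat_def finite)
      with i that show ?thesis
        by (metis (mono_tags, lifting) mem_Collect_eq)
    qed
    moreover have "t $ i = s $ i + - 2 * s $ i"
    proof -
      have "s $ i = 1 \<or> s $ i = -1" "t $ i = 1 \<or> t $ i = -1"
        using hyp t by (auto simp: hypercube_def)
      with i show ?thesis
        by auto
    qed
    ultimately have "t = s + axis i (- 2 * s $ i)"
      by (simp add: vec_eq_iff axis_def)
    then have "energy J t = energy J s + 2 * (s $ i * (J *v s) $ i)"
      by (simp add: energy_add_axis[OF assms])
    then show ?thesis
      using nonneg[of i] by linarith
  qed simp
  with hyp show "s \<in> one_flip_minima (energy J)"
    by (simp add: one_flip_minima_def)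
qed

text \<open>Here \<open>a\<close> stands for the constant slope that the energy contributes along a
  coordinate line. If no such \<open>t\<close> existed, \<open>f y - a * y\<close> would have a
  local minimum at \<open>x\<close>, forcing \<open>deriv f x = a\<close>. But
  \<open>deriv f\<close> lies below \<open>a\<close> just to the right of \<open>x\<close>, so by
  the mean value theorem \<open>f y - a * y\<close> decreases there.\<close>

lemma no_local_min_if_second_deriv_neg:
  fixes f :: "real \<Rightarrow> real"
  assumes "twice_differentiable f" "deriv (deriv f) x < 0" "\<epsilon> > 0"
  shows "\<exists>t. \<bar>t\<bar> < \<epsilon> \<and> f (x + t) - f x < a * t"
proof (rule ccontr)
  assume contra: "\<not> ?thesis"
  have D1: "(f has_real_derivative deriv f y) (at y)"
    and D2: "(deriv f has_real_derivative deriv (deriv f) y) (at y)" for y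
    using assms(1) by (simp_all add: twice_differentiable_def DERIV_deriv_iff_real_differentiable)
  have "((\<lambda>y. f y - a * y) has_real_derivative deriv f x - a) (at x)"
    by (auto intro!: derivative_eq_intros D1)
  moreover have "f x - a * x \<le> f y - a * y" if "\<bar>x - y\<bar> < \<epsilon>" for y
    using contra[simplified, rule_format, of "y - x"] that
    by (simp add: abs_minus_commute right_diff_distrib)
  ultimately have a: "deriv f x = a"
    using DERIV_local_min[OF _ assms(3), of "\<lambda>y. f y - a * y" "deriv f x - a" x] by auto
  obtain d where d: "d > 0" "\<And>h. 0 < h \<Longrightarrow> h < d \<Longrightarrow> deriv f (x + h) < deriv f x"
    using DERIV_neg_dec_right[OF D2 assms(2)] by blast
  define h where "h = min d \<epsilon> / 2"
  have h: "0 < h" "h < d" "h < \<epsilon>"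
    using d(1) assms(3) by (auto simp: h_def)
  obtain z where z: "x < z" "z < x + h" "f (x + h) - f x = (x + h - x) * deriv f z"
    using MVT2[of x "x + h" f "deriv f"] D1 h(1) by auto
  have "deriv f z < a"
    using d(2)[of "z - x"] z h a by simp
  then have "f (x + h) - f x < a * h"
    using z(3) h(1) by (simp add: mult.commute)
  with contra h show False
    by auto
qed

theorem theorem3p13:
  fixes J :: "real ^ 'n ^ 'n"
    and lam \<gamma> :: real
    and f :: "real \<Rightarrow> real"
  assumes "J \<noteq> 0"
    and "transpose J = J"
    and "\<And>i. J $ i $ i = 0"
    and "lam > 0"
    and "\<gamma> = margin J"
    and "twice_differentiable f"
    and "admissible lam \<gamma> f"
  shows "local_minima_on (scaled_cube lam) (hamiltonian J f)
           = (\<lambda>s. lam *\<^sub>R s) ` one_flip_minima (energy J)"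
proof (intro equalityI subsetI)

  \<comment> \<open>Local minima over the cube are scaled one-flip minima\<close>
  note H_axis = hamiltonian_add_axis[OF assms(2,3)]
  have even: "f (- x) = f x" and concave: "\<bar>x\<bar> < lam \<Longrightarrow> deriv (deriv f) x < 0"
    and deriv_gt: "deriv f lam + lam * \<gamma> > 0" for x
    using assms(7) by (auto simp: admissible_def)
  have Df: "(f has_real_derivative deriv f lam) (at lam)"
    using assms(6) by (simp add: twice_differentiable_def DERIV_deriv_iff_real_differentiable)
  fix x
  assume x: "x \<in> local_minima_on (scaled_cube lam) (hamiltonian J f)"
  then obtain \<epsilon> where xc: "x \<in> scaled_cube lam" and \<epsilon>: "\<epsilon> > 0"
    and lmin: "\<And>y. y \<in> scaled_cube lam \<Longrightarrow> dist y x < \<epsilon> \<Longrightarrow> hamiltonian J f x \<le> hamiltonian J f y"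
    by (auto simp: local_minima_on_def)
  have bound: "\<bar>x $ i\<bar> \<le> lam" for i
    using xc by (simp add: scaled_cube_def abs_le_iff minus_le_iff[of "x $ i"])
  \<comment> \<open>Only competitors that differ from \<open>x\<close> in one coordinate are used in
    this direction.\<close>
  have coord: "t * (J *v x) $ i \<le> f (x $ i + t) - f (x $ i)"
    if "\<bar>t\<bar> < \<epsilon>" "\<bar>x $ i + t\<bar> \<le> lam" for i t
  proof -
    have "x + axis i t \<in> scaled_cube lam"
      using xc that(2) by (auto simp: scaled_cube_def axis_def abs_le_iff)
    moreover have "dist (x + axis i t) x < \<epsilon>"
      using that(1) by (simp add: dist_norm norm_eq_sqrt_inner inner_axis_axis)
    ultimately show ?thesis
      using lmin H_axis[of f x i t] by fastforce
  qed
  have vertex: "\<bar>x $ i\<bar> = lam" for i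
  proof (rule ccontr)
    assume "\<bar>x $ i\<bar> \<noteq> lam"
    then have lt: "\<bar>x $ i\<bar> < lam"
      using bound[of i] by simp
    \<comment> \<open>A move shorter than \<open>e\<close> stays both in the ball of local
      minimality and in the cube.\<close>
    define e where "e = min \<epsilon> (lam - \<bar>x $ i\<bar>)"
    have "e > 0"
      using lt \<epsilon> by (simp add: e_def)
    then obtain t where "\<bar>t\<bar> < e" "f (x $ i + t) - f (x $ i) < (J *v x) $ i * t"
      using no_local_min_if_second_deriv_neg[OF assms(6) concave[OF lt]] by blast
    with coord[of t i] show False
      using abs_triangle_ineq[of "x $ i" t] by (auto simp: e_def mult.commute)
  qed
  define s where "s = (1 / lam) *\<^sub>R x"
  have xs: "x = lam *\<^sub>R s"
    using assms(4) by (simp add: s_def)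
  have hyp: "s \<in> hypercube"
    unfolding hypercube_def
  proof (intro CollectI allI)
    fix i
    have "x $ i = lam \<or> x $ i = - lam"
      using vertex[of i] by linarith
    then show "s $ i \<in> {-1, 1}"
      using assms(4) by (auto simp: s_def)
  qed
  have "0 \<le> s $ i * (J *v s) $ i" for i
  proof (rule ccontr)
    assume "\<not> ?thesis"
    then have neg: "\<gamma> \<le> - (s $ i * (J *v s) $ i)"
      using margin_le[OF hyp] assms(5) by simp
    have s: "s $ i = 1 \<or> s $ i = -1"
      using hyp by (auto simp: hypercube_def)
    \<comment> \<open>This is \<open>s $ i * (J *v x) $ i\<close>, the rate at which the energy
      changes as coordinate \<open>i\<close> moves inwards. Up to a constant,
      \<open>f y - b * y\<close> at \<open>y = lam - h\<close> is the Hamiltonian after an inward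
      move of length \<open>h\<close>.\<close>
    define b where "b = lam * (s $ i * (J *v s) $ i)"
    have "lam * \<gamma> \<le> - b"
      using mult_left_mono[OF neg, of lam] assms(4) by (simp add: b_def)
    with deriv_gt have "deriv f lam - b > 0"
      by simp
    moreover have "((\<lambda>y. f y - b * y) has_real_derivative deriv f lam - b) (at lam)"
      by (auto intro!: derivative_eq_intros Df)
    ultimately obtain d where d: "d > 0"
      "\<And>h. 0 < h \<Longrightarrow> h < d \<Longrightarrow> f (lam - h) - b * (lam - h) < f lam - b * lam"
      using DERIV_pos_inc_left by blast
    define h where "h = min d (min \<epsilon> lam) / 2"
    have h: "0 < h" "h < d" "h < \<epsilon>" "h < lam"
      using d(1) \<epsilon> assms(4) by (auto simp: h_def)
    have "f (lam - h) - f lam < - (h * b)"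
      using d(2)[OF h(1,2)] by (simp add: algebra_simps)
    moreover have "(J *v x) $ i = lam * (J *v s) $ i"
      by (simp add: xs matrix_vector_mult_scaleR)
    moreover have "f (x $ i) = f lam" "f (x $ i + - h * s $ i) = f (lam - h)"
      \<comment> \<open>Evenness carries the case \<open>s $ i = -1\<close> over to the endpoint
        \<open>lam\<close>.\<close>
      using s even[of lam] even[of "lam - h"] by (auto simp: xs)
    moreover have "\<bar>- h * s $ i\<bar> < \<epsilon>" "\<bar>x $ i + - h * s $ i\<bar> \<le> lam"
      using s h by (auto simp: xs)
    ultimately show False
      using coord[of "- h * s $ i" i] by (simp add: b_def algebra_simps)
  qed
  then show "x \<in> (\<lambda>s. lam *\<^sub>R s) ` one_flip_minima (energy J)"
    using hyp xs unfolding one_flip_minima_energy[OF assms(2,3)] by blast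
next

  \<comment> \<open>Scaled one-flip minima are local minima over the cube\<close>
  fix x
  assume "x \<in> (\<lambda>s. lam *\<^sub>R s) ` one_flip_minima (energy J)"
  then obtain s where xs: "x = lam *\<^sub>R s" and hyp: "s \<in> hypercube"
    and nonneg: "\<And>i. 0 \<le> s $ i * (J *v s) $ i"
    unfolding one_flip_minima_energy[OF assms(2,3)] by blast
  have even: "f (- y) = f y" and deriv_neg: "deriv f lam < 0" for y
    using assms(7) by (auto simp: admissible_def)
  have s: "s $ i = 1 \<or> s $ i = -1" for i
    using hyp by (auto simp: hypercube_def)
  \<comment> \<open>Half of the inward slope of \<open>f\<close> at \<open>lam\<close>: adding
    \<open>c * y\<close> keeps the derivative negative, so a short inward move of length
    \<open>h\<close> gains at least \<open>c * h\<close>.\<close>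
  define c where "c = - deriv f lam / 2"
  have c: "c > 0"
    using deriv_neg by (simp add: c_def)
  have "(f has_real_derivative deriv f lam) (at lam)"
    using assms(6) by (simp add: twice_differentiable_def DERIV_deriv_iff_real_differentiable)
  then have "((\<lambda>y. f y + c * y) has_real_derivative - c) (at lam)"
    by (auto intro!: derivative_eq_intros simp: c_def)
  then obtain d where d: "d > 0"
    "\<And>h. 0 < h \<Longrightarrow> h < d \<Longrightarrow> f (lam - h) + c * (lam - h) > f lam + c * lam"
    using DERIV_neg_dec_left[of "\<lambda>y. f y + c * y" "- c" lam] c by auto
  obtain K where K: "K > 0" "\<And>z. norm (J *v z) \<le> norm z * K"
    using bounded_linear.pos_bounded[OF matrix_vector_mul_bounded_linear[of J]] by blast
  \<comment> \<open>The bound \<open>d\<close> secures the gain of \<open>f\<close> in each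
    coordinate; \<open>c / K\<close> bounds the quadratic form at \<open>z\<close> by
    \<open>c * norm z\<close>.\<close>
  define \<epsilon> where "\<epsilon> = min d (c / K)"
  have \<epsilon>: "\<epsilon> > 0"
    using d(1) c K(1) by (simp add: \<epsilon>_def)
  have "hamiltonian J f x \<le> hamiltonian J f y"
    if y: "y \<in> scaled_cube lam" and dist: "dist y x < \<epsilon>" for y
  proof -
    define z where "z = y - x"
    have nz: "norm z < d" "norm z < c / K"
      using dist by (auto simp: z_def dist_norm \<epsilon>_def)
    have zi: "\<bar>z $ i\<bar> = lam - s $ i * y $ i" for i
      using s[of i] y by (auto simp: z_def xs scaled_cube_def dest: spec[of _ i])
    \<comment> \<open>As \<open>x\<close> is a vertex of the cube, every feasible displacement
      points inwards in each coordinate.\<close>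
    have zs: "z $ i = - s $ i * \<bar>z $ i\<bar>" for i
      unfolding zi using s[of i] by (auto simp: z_def xs)
    have f_gain: "c * \<bar>z $ i\<bar> \<le> f (y $ i) - f (x $ i)" for i
    proof -
      have "f (x $ i) = f lam" "f (y $ i) = f (lam - \<bar>z $ i\<bar>)"
        using s[of i] even[of lam] even[of "y $ i"] unfolding zi by (auto simp: xs)
      moreover have "\<bar>z $ i\<bar> < d"
        using component_le_norm_cart[of z i] nz(1) by simp
      ultimately show ?thesis
        using d(2)[of "\<bar>z $ i\<bar>"] by (cases "z $ i = 0") (auto simp: algebra_simps)
    qed
    have "z \<bullet> (J *v x) \<le> 0"
    proof -
      have "z $ i * (J *v x) $ i \<le> 0" for i
      proof -
        have "z $ i * (J *v x) $ i = - (lam * \<bar>z $ i\<bar> * (s $ i * (J *v s) $ i))"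
          by (subst zs) (simp add: xs matrix_vector_mult_scaleR)
        also have "\<dots> \<le> 0"
          using nonneg[of i] assms(4) by simp
        finally show ?thesis .
      qed
      then show ?thesis
        by (simp add: inner_vec_def sum_nonpos)
    qed
    moreover have "(1 / 2) * (z \<bullet> (J *v z)) \<le> c * norm z"
    proof -
      have "z \<bullet> (J *v z) \<le> norm z * norm (J *v z)"
        by (rule norm_cauchy_schwarz)
      also have "\<dots> \<le> norm z * (norm z * K)"
        by (intro mult_left_mono K) simp
      also have "\<dots> \<le> norm z * c"
        using nz(2) K(1) by (intro mult_left_mono) (auto simp: field_simps)
      finally have "z \<bullet> (J *v z) \<le> c * norm z"
        by (simp add: mult.commute)
      moreover have "0 \<le> c * norm z"
        using c by simp
      ultimately show ?thesis
        by linarith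
    qed
    moreover have "c * norm z \<le> (\<Sum>i\<in>UNIV. f (y $ i)) - (\<Sum>i\<in>UNIV. f (x $ i))"
    proof -
      \<comment> \<open>The coordinatewise gains add up to \<open>c\<close> times the l1 norm, which
        dominates the Euclidean norm.\<close>
      have "c * norm z \<le> c * (\<Sum>i\<in>UNIV. \<bar>z $ i\<bar>)"
        using c norm_le_l1_cart[of z] by simp
      also have "\<dots> \<le> (\<Sum>i\<in>UNIV. f (y $ i) - f (x $ i))"
        unfolding sum_distrib_left by (intro sum_mono f_gain)
      finally show ?thesis
        by (simp add: sum_subtractf)
    qed
    moreover have "energy J y = energy J x - z \<bullet> (J *v x) - (1 / 2) * (z \<bullet> (J *v z))"
      using energy_add[OF assms(2), of x z] by (simp add: z_def)
    ultimately show ?thesis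
      unfolding hamiltonian_def by linarith
  qed
  moreover have "x \<in> scaled_cube lam"
    unfolding scaled_cube_def
  proof (intro CollectI allI)
    show "x $ i \<in> {-lam..lam}" for i
      using s[of i] assms(4) by (auto simp: xs)
  qed
  ultimately show "x \<in> local_minima_on (scaled_cube lam) (hamiltonian J f)"
    using \<epsilon> by (auto simp: local_minima_on_def)
qed

end
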